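(* For all $x \in [0,\pi_{4/3,2}/2]$, $$\sin_{4/3,2}(2x)=\frac{4\,\sin_{4/3,2}(x)\,(\cos_{4/3,2}(x))^{1/3}\,\bigl(1+(\cos_{4/3,2}(x))^{4/3}\bigr)}{\bigl(2(\cos_{4/3,2}(x))^{2/3}+(\sin_{4/3,2}(x))^2\bigr)^2}.$$
   Context: Generalized trigonometric functions. For real $p,q>1$, let $F(x):=\int_0^x \frac{dt}{(1-t^q)^{1/p}}$ for $x\in[0,1]$ and $\pi_{p,q}:=2F(1)=2\int_0^1 \frac{dt}{(1-t^q)^{1/p}}$. The function $\sin_{p,q}$ is defined on $[0,\pi_{p,q}/2]$ as the inverse function $F^{-1}$, an increasing function onto $[0,1]$. It is extended to $(\pi_{p,q}/2,\pi_{p,q}]$ by $\sin_{p,q}(x):=\sin_{p,q}(\pi_{p,q}-x)$, and then to all of $\mathbb{R}$ as the odd $2\pi_{p,q}$-periodic continuation. The resulting function is $C^1$ on $\mathbb{R}$, and $\cos_{p,q}(x):=\frac{d}{dx}\sin_{p,q}(x)$ for $x \in \mathbb{R}$. On $[0,\pi_{p,q}/2]$ one has $\cos_{p,q}(x)\ge 0$, and fractional powers of it denote the usual nonnegative real powers. The theorem concerns the case $(p,q)=(4/3,2)$. *)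

theory Defs
  imports "HOL-Analysis.Analysis"
begin

(* For p > 1 and q > 1 the integrand is nonnegative and singular only at t = 1, where it
   is integrably unbounded and HOL assigns it the value 0.  The Henstock-Kurzweil integral
   over {0..1} therefore agrees with the improper integral. *)
definition arcsin_pq :: "real \<Rightarrow> real \<Rightarrow> real \<Rightarrow> real" where
  "arcsin_pq p q x = integral {0..x} (\<lambda>t. 1 / (1 - t powr q) powr (1 / p))"

definition pi_pq :: "real \<Rightarrow> real \<Rightarrow> real" where
  "pi_pq p q = 2 * arcsin_pq p q 1"

(* Only meaningful for x in {0..pi_pq p q}. *)
definition sin_pq_base :: "real \<Rightarrow> real \<Rightarrow> real \<Rightarrow> real" where
  "sin_pq_base p q x =
     (if x \<le> pi_pq p q / 2 then inv_into {0..1} (arcsin_pq p q) x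
      else inv_into {0..1} (arcsin_pq p q) (pi_pq p q - x))"

(* The odd 2 * pi_pq-periodic continuation: y is the translate of x by a multiple of
   the period that lies in {- pi_pq p q..<pi_pq p q}. *)
definition sin_pq :: "real \<Rightarrow> real \<Rightarrow> real \<Rightarrow> real" where
  "sin_pq p q x =
     (let y = x - 2 * pi_pq p q * of_int (round (x / (2 * pi_pq p q)))
      in if 0 \<le> y then sin_pq_base p q y else - sin_pq_base p q (- y))"

definition cos_pq :: "real \<Rightarrow> real \<Rightarrow> real \<Rightarrow> real" where
  "cos_pq p q x = deriv (sin_pq p q) x"

end

theory Submission
  imports Defs
begin

text \<open>
  Put \<open>s = sin x\<close>, \<open>c = cos x\<close> (both for the parameters \<open>p = 4/3\<close>, \<open>q = 2\<close>) and \<open>u = c powr (1/3)\<close>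
  on the quarter period. Then \<open>u\<^sup>4 = 1 - s\<^sup>2\<close>, and \<open>s' = u\<^sup>3\<close> yields \<open>u' = - s / 2 = - sqrt (1 - u\<^sup>4) / 2\<close>.
  So \<open>u\<close> satisfies the differential equation of the lemniscate functions: the arc \<open>x\<close>, as a
  function of \<open>u\<close>, is twice the lemniscatic integral of \<open>dw / sqrt (1 - w\<^sup>4)\<close> from \<open>u\<close> to \<open>1\<close>,
  and the double-angle formula is a disguise of the duplication formula for the lemniscatic cosine,
  \<open>U = (u\<^sup>4 + 2 u\<^sup>2 - 1) / (1 + 2 u\<^sup>2 - u\<^sup>4)\<close>.

  Two algebraic facts carry the argument. The right-hand side of the theorem is exactly
  \<open>sqrt (1 - U\<^sup>4)\<close> (lemma \<open>sqrt_one_minus_double_root_power4\<close>), and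
  \<open>dU / sqrt (1 - U\<^sup>4) = 2 du / sqrt (1 - u\<^sup>4)\<close>. By the second one the arc belonging to \<open>U\<close> grows twice
  as fast as the arc belonging to \<open>u\<close>, and since the two vanish together at \<open>u = 1\<close>, it is twice as
  long. Once \<open>U\<close> is negative, that is once \<open>2 x\<close> has passed the quarter period, the arc belonging to
  \<open>- U\<close> is the reflection \<open>pi_pq (4/3) 2 - 2 x\<close> instead, by the same comparison started at \<open>u = 0\<close>
  (lemma \<open>arc_of_double_root\<close>). In both cases the generalized sine of that arc is \<open>sin (2 x)\<close>.

  Applying this requires that the sine inverts the arc integral and that its derivative is
  \<open>(1 - s powr q) powr (1/p)\<close>, which holds for all \<open>p, q > 1\<close>. The delicate point is the end of the
  quarter period: there the integrand is unbounded, so that the inverse function rule fails, and the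
  derivative has to be two-sided.
\<close>

section \<open>The arc function and its inverse\<close>

context
  fixes p q :: real
  assumes p: "p > 1" and q: "q > 1"
begin

lemma powr_exponent_gt_1_less_1:
  assumes "0 \<le> t" "t < 1"
  shows "t powr q < (1::real)"
  using assms q powr_less_mono2[of q t 1] by simp

text \<open>
  As \<open>t powr q \<le> t\<close> on the unit interval, the integrand is dominated by \<open>(1 - t) powr (-1/p)\<close>.
  The latter has a primitive that stays continuous at \<open>1\<close>, because \<open>1 - 1/p > 0\<close>.
\<close>

lemma integrand_integrable:
  "(\<lambda>t. 1 / (1 - t powr q) powr (1/p)) integrable_on {0..1}"
proof -
  define c where "c = 1 - 1/p"
  have c: "c > 0" using p by (simp add: c_def)
  have "((\<lambda>t. 1 / (1 - t) powr (1/p)) has_integral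
          - ((1 - 1) powr c / c) - - ((1 - 0) powr c / c)) {0..1}"
  proof (rule fundamental_theorem_of_calculus_interior)
    show "continuous_on {0..1} (\<lambda>t. - ((1 - t) powr c / c))"
      using c by (intro continuous_intros continuous_on_powr') auto
    show "((\<lambda>t. - ((1 - t) powr c / c)) has_vector_derivative 1 / (1 - t) powr (1/p)) (at t)"
      if "t \<in> {0<..<1}" for t
    proof -
      have "((\<lambda>t. - ((1 - t) powr c / c)) has_real_derivative (1 - t) powr (c - 1)) (at t)"
        using that c by (auto intro!: derivative_eq_intros)
      moreover have "(1 - t) powr (c - 1) = 1 / (1 - t) powr (1/p)"
        by (simp add: c_def powr_minus_divide)
      ultimately show ?thesis
        by (simp add: has_real_derivative_iff_has_vector_derivative)
    qed
  qed simp
  then have majorant: "(\<lambda>t. 1 / (1 - t) powr (1/p)) integrable_on {0..1}"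
    by blast
  show ?thesis
  proof (rule measurable_bounded_by_integrable_imp_integrable[OF _ majorant])
    have "(\<lambda>t::real. 1 / (1 - t powr q) powr (1/p)) \<in> borel_measurable lborel"
      by measurable
    then show "(\<lambda>t. 1 / (1 - t powr q) powr (1/p)) \<in> borel_measurable (lebesgue_on {0..1})"
      by (intro measurable_restrict_space1 measurable_completion)
    show "norm (1 / (1 - t powr q) powr (1/p)) \<le> 1 / (1 - t) powr (1/p)"
      if "t \<in> {0..1}" for t
    proof (cases "t = 1")
      case False
      have "t powr q \<le> t powr 1"
        using that q by (intro powr_mono') auto
      then have "(1 - t) powr (1/p) \<le> (1 - t powr q) powr (1/p)"
        using that p by (intro powr_mono2) auto
      then show ?thesis
        using that False by (auto intro!: divide_left_mono mult_pos_pos)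
    qed simp
  qed simp
qed

lemma arcsin_pq_0: "arcsin_pq p q 0 = 0"
  by (simp add: arcsin_pq_def)

lemma arcsin_pq_1: "arcsin_pq p q 1 = pi_pq p q / 2"
  by (simp add: pi_pq_def)

lemma continuous_on_arcsin_pq: "continuous_on {0..1} (arcsin_pq p q)"
  using indefinite_integral_continuous_1[OF integrand_integrable]
  by (simp add: arcsin_pq_def[abs_def])

lemma DERIV_arcsin_pq:
  assumes "0 < s" "s < 1"
  shows "(arcsin_pq p q has_real_derivative 1 / (1 - s powr q) powr (1/p)) (at s)"
proof -
  define b where "b = (1 + s) / 2"
  have b: "s < b" "b < 1" using assms by (auto simp: b_def)
  have lt1: "t powr q < 1" if "t \<in> {0..b}" for t
    using that b by (intro powr_exponent_gt_1_less_1) auto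
  have "continuous_on {0..b} (\<lambda>t. 1 / (1 - t powr q) powr (1/p))"
  proof (intro continuous_on_divide continuous_on_powr' continuous_on_diff continuous_on_const
      continuous_on_id ballI conjI impI)
    show "(1 - t powr q) powr (1/p) \<noteq> 0" if "t \<in> {0..b}" for t
      using lt1[OF that] by simp
  qed (use lt1 p q in \<open>auto simp: less_imp_le\<close>)
  from integral_has_real_derivative[OF this, of s]
  show ?thesis
    using assms b at_within_Icc_at[of 0 s b] by (simp add: arcsin_pq_def[abs_def])
qed

lemma arcsin_pq_strict_mono:
  assumes "0 \<le> s" "s < t" "t \<le> 1"
  shows "arcsin_pq p q s < arcsin_pq p q t"
proof (rule DERIV_pos_imp_increasing_open[OF assms(2)])
  show "continuous_on {s..t} (arcsin_pq p q)"
    using continuous_on_arcsin_pq by (rule continuous_on_subset) (use assms in auto)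
  show "\<exists>D. (arcsin_pq p q has_real_derivative D) (at r) \<and> 0 < D" if "s < r" "r < t" for r
    using DERIV_arcsin_pq[of r] powr_exponent_gt_1_less_1[of r] that assms
    by (intro exI conjI) (auto simp: less_eq_real_def)
qed

lemma pi_pq_pos: "pi_pq p q > 0"
  using arcsin_pq_strict_mono[of 0 1] by (simp add: arcsin_pq_0 arcsin_pq_1)

lemma inj_on_arcsin_pq: "inj_on (arcsin_pq p q) {0..1}"
  by (rule linorder_inj_onI) (auto dest!: arcsin_pq_strict_mono)

lemma arcsin_pq_image: "arcsin_pq p q ` {0..1} = {0..pi_pq p q / 2}"
proof
  have "arcsin_pq p q s \<in> {0..pi_pq p q / 2}" if "s \<in> {0..1}" for s
    using arcsin_pq_strict_mono[of 0 s] arcsin_pq_strict_mono[of s 1] pi_pq_pos that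
    by (cases "s = 0"; cases "s = 1") (auto simp: arcsin_pq_0 arcsin_pq_1)
  then show "arcsin_pq p q ` {0..1} \<subseteq> {0..pi_pq p q / 2}" by blast
  show "{0..pi_pq p q / 2} \<subseteq> arcsin_pq p q ` {0..1}"
    using IVT'[of "arcsin_pq p q" 0 _ 1] continuous_on_arcsin_pq
    by (fastforce simp: arcsin_pq_0 arcsin_pq_1)
qed

section \<open>The generalized sine and cosine on the first half period\<close>

lemma sin_pq_eq_base:
  assumes "0 \<le> x" "x < pi_pq p q"
  shows "sin_pq p q x = sin_pq_base p q x"
proof -
  have "round (x / (2 * pi_pq p q)) = 0"
    using assms pi_pq_pos by (intro round_unique') (auto simp: field_simps)
  then show ?thesis using assms by (simp add: sin_pq_def)
qed

lemma sin_pq_eq_inv_into: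
  assumes "x \<in> {0..pi_pq p q / 2}"
  shows "sin_pq p q x = inv_into {0..1} (arcsin_pq p q) x"
  using assms pi_pq_pos by (simp add: sin_pq_eq_base sin_pq_base_def)

lemma sin_pq_arcsin_pq:
  assumes "s \<in> {0..1}"
  shows "sin_pq p q (arcsin_pq p q s) = s"
  using assms inj_on_arcsin_pq arcsin_pq_image
  by (subst sin_pq_eq_inv_into) (auto simp: image_subset_iff)

lemma sin_pq_in_unit:
  assumes "x \<in> {0..pi_pq p q / 2}"
  shows "sin_pq p q x \<in> {0..1}"
  using assms inv_into_into[of x "arcsin_pq p q" "{0..1}"]
  by (simp only: sin_pq_eq_inv_into arcsin_pq_image)

lemma arcsin_pq_sin_pq:
  assumes "x \<in> {0..pi_pq p q / 2}"
  shows "arcsin_pq p q (sin_pq p q x) = x"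
  using assms by (simp only: sin_pq_eq_inv_into f_inv_into_f arcsin_pq_image)

lemma sin_pq_0: "sin_pq p q 0 = 0"
  using sin_pq_arcsin_pq[of 0] by (simp add: arcsin_pq_0)

lemma sin_pq_half_pi: "sin_pq p q (pi_pq p q / 2) = 1"
  using sin_pq_arcsin_pq[of 1] by (simp add: arcsin_pq_1)

text \<open>
  At \<open>x = 0\<close> this is not the defining reflection: \<open>pi_pq p q\<close> lies half a period away from \<open>0\<close>, the tie
  in \<open>round\<close> is broken upwards, and the value is computed as the odd continuation at \<open>- pi_pq p q\<close>.
\<close>

lemma sin_pq_reflect:
  assumes "x \<in> {0..pi_pq p q}"
  shows "sin_pq p q (pi_pq p q - x) = sin_pq p q x"
proof -
  have pi: "sin_pq p q (pi_pq p q) = 0"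
  proof -
    have "round (pi_pq p q / (2 * pi_pq p q)) = 1"
      using pi_pq_pos by (simp add: round_def)
    moreover have "inv_into {0..1} (arcsin_pq p q) 0 = 0"
      using sin_pq_0 pi_pq_pos by (simp add: sin_pq_eq_inv_into)
    ultimately show ?thesis
      using pi_pq_pos by (simp add: sin_pq_def sin_pq_base_def)
  qed
  consider "x = 0" | "x = pi_pq p q" | "0 < x" "x < pi_pq p q"
    using assms by force
  then show ?thesis
  proof cases
    case 3
    show ?thesis
    proof (cases "x = pi_pq p q / 2")
      case True
      then have "pi_pq p q - x = x" by linarith
      then show ?thesis by metis
    next
      case False
      with 3 show ?thesis by (auto simp: sin_pq_eq_base sin_pq_base_def)
    qed
  qed (simp_all add: pi sin_pq_0)
qed

lemma continuous_on_sin_pq: "continuous_on {0..pi_pq p q / 2} (sin_pq p q)"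
  using continuous_on_inv[OF continuous_on_arcsin_pq compact_Icc, of "sin_pq p q"]
  by (simp add: arcsin_pq_image sin_pq_arcsin_pq)

lemma sin_pq_in_open_unit:
  assumes "0 < x" "x < pi_pq p q / 2"
  shows "sin_pq p q x \<in> {0<..<1}"
proof -
  have "sin_pq p q x \<noteq> 0" "sin_pq p q x \<noteq> 1"
    using arcsin_pq_sin_pq[of x] assms by (auto simp: arcsin_pq_0 arcsin_pq_1)
  then show ?thesis using sin_pq_in_unit[of x] assms by auto
qed

lemma DERIV_sin_pq:
  assumes "0 < x" "x < pi_pq p q / 2"
  shows "(sin_pq p q has_real_derivative (1 - sin_pq p q x powr q) powr (1/p)) (at x)"
proof -
  have s: "sin_pq p q x \<in> {0<..<1}"
    by (rule sin_pq_in_open_unit[OF assms])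
  have "(sin_pq p q has_real_derivative inverse (1 / (1 - sin_pq p q x powr q) powr (1/p))) (at x)"
  proof (rule DERIV_inverse_function)
    show "(arcsin_pq p q has_real_derivative 1 / (1 - sin_pq p q x powr q) powr (1/p))
            (at (sin_pq p q x))"
      using s by (intro DERIV_arcsin_pq) auto
    show "1 / (1 - sin_pq p q x powr q) powr (1/p) \<noteq> 0"
      using s powr_exponent_gt_1_less_1[of "sin_pq p q x"] by auto
    show "arcsin_pq p q (sin_pq p q y) = y" if "0 < y" "y < pi_pq p q / 2" for y
      using that by (intro arcsin_pq_sin_pq) auto
    show "isCont (sin_pq p q) x"
      using continuous_on_interior[OF continuous_on_sin_pq] assms by simp
  qed (use assms in auto)
  then show ?thesis by simp
qed

text \<open>
  By the reflection symmetry it suffices to look at \<open>pi_pq p q / 2 - h\<close> with \<open>h > 0\<close>, where the sine is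
  some \<open>s < 1\<close>. The mean value theorem for the arc function on \<open>{s..1}\<close>, whose slope at interior
  points is at least \<open>1 / (1 - s powr q) powr (1/p)\<close>, bounds the difference quotient \<open>(1 - s) / h\<close>
  by \<open>(1 - s powr q) powr (1/p)\<close>. This tends to \<open>0\<close>, because \<open>s\<close> tends to \<open>1\<close> by continuity.
\<close>

lemma DERIV_sin_pq_half_pi: "(sin_pq p q has_real_derivative 0) (at (pi_pq p q / 2))"
proof -
  let ?P = "pi_pq p q / 2" and ?S = "\<lambda>h. sin_pq p q (pi_pq p q / 2 - \<bar>h\<bar>)"
  have sym: "sin_pq p q (?P + h) = ?S h" if "\<bar>h\<bar> \<le> ?P" for h
    using sin_pq_reflect[of "?P + h"] that by (cases "h \<ge> 0") auto
  have bound: "\<bar>(sin_pq p q (?P + h) - sin_pq p q ?P) / h\<bar> \<le> (1 - ?S h powr q) powr (1/p)"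
    if "h \<noteq> 0" "\<bar>h\<bar> < ?P" for h
  proof -
    have S: "?S h \<in> {0<..<1}"
      using that by (intro sin_pq_in_open_unit) auto
    have "\<exists>l \<xi>. ?S h < \<xi> \<and> \<xi> < 1 \<and> (arcsin_pq p q has_real_derivative l) (at \<xi>)
        \<and> arcsin_pq p q 1 - arcsin_pq p q (?S h) = (1 - ?S h) * l"
    proof (rule MVT)
      show "continuous_on {?S h..1} (arcsin_pq p q)"
        using continuous_on_arcsin_pq by (rule continuous_on_subset) (use S in auto)
      show "arcsin_pq p q differentiable (at y)" if "?S h < y" "y < 1" for y
        using DERIV_arcsin_pq[of y] that S by (auto simp: real_differentiable_def)
    qed (use S in auto)
    then obtain l \<xi> where \<xi>: "?S h < \<xi>" "\<xi> < 1"
      and l: "(arcsin_pq p q has_real_derivative l) (at \<xi>)"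
             "arcsin_pq p q 1 - arcsin_pq p q (?S h) = (1 - ?S h) * l"
      by blast
    have "l = 1 / (1 - \<xi> powr q) powr (1/p)"
      using DERIV_unique[OF l(1) DERIV_arcsin_pq] \<xi> S by auto
    moreover have "arcsin_pq p q 1 - arcsin_pq p q (?S h) = \<bar>h\<bar>"
      using that by (simp add: arcsin_pq_sin_pq arcsin_pq_1)
    moreover have "\<xi> powr q < 1"
      using \<xi> S by (intro powr_exponent_gt_1_less_1) auto
    ultimately have "\<bar>h\<bar> = (1 - ?S h) / (1 - \<xi> powr q) powr (1/p)"
      and \<xi>_pos: "(1 - \<xi> powr q) powr (1/p) > 0"
      using l(2) by simp_all
    then have "1 - ?S h = \<bar>h\<bar> * (1 - \<xi> powr q) powr (1/p)"
      by (simp add: eq_divide_eq)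
    moreover have "?S h powr q \<le> \<xi> powr q"
      using \<xi> S q by (intro powr_mono2) auto
    then have "(1 - \<xi> powr q) powr (1/p) \<le> (1 - ?S h powr q) powr (1/p)"
      using \<open>\<xi> powr q < 1\<close> p by (intro powr_mono2) auto
    moreover have "\<bar>(sin_pq p q (?P + h) - sin_pq p q ?P) / h\<bar> = (1 - ?S h) / \<bar>h\<bar>"
      using sym[of h] that S by (simp add: sin_pq_half_pi abs_div_pos)
    ultimately show ?thesis
      using that by simp
  qed
  have "(?S \<longlongrightarrow> sin_pq p q ?P) (at 0)"
  proof (rule continuous_on_tendsto_compose[OF continuous_on_sin_pq])
    have "((\<lambda>h::real. ?P - \<bar>h\<bar>) \<longlongrightarrow> ?P - \<bar>0\<bar>) (at 0)"
      by (intro tendsto_intros)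
    then show "((\<lambda>h::real. ?P - \<bar>h\<bar>) \<longlongrightarrow> ?P) (at 0)" by simp
    show "\<forall>\<^sub>F h in at 0. ?P - \<bar>h\<bar> \<in> {0..?P}"
      using pi_pq_pos by (auto simp: eventually_at dist_real_def intro!: exI[of _ ?P])
  qed (use pi_pq_pos in auto)
  then have S_lim: "(?S \<longlongrightarrow> 1) (at 0)" by (simp add: sin_pq_half_pi)
  have "((\<lambda>h. (1 - ?S h powr q) powr (1/p)) \<longlongrightarrow> (1 - 1 powr q) powr (1/p)) (at 0)"
  proof (intro tendsto_powr' tendsto_diff tendsto_const S_lim)
    have "\<forall>\<^sub>F h in at 0. \<bar>h\<bar> < ?P"
      using pi_pq_pos by (auto simp: eventually_at dist_real_def intro!: exI[of _ ?P])
    then have "\<forall>\<^sub>F h in at 0. 0 \<le> 1 - ?S h powr q"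
    proof eventually_elim
      case (elim h)
      then show ?case
        using sin_pq_in_unit[of "?P - \<bar>h\<bar>"] q by (auto intro!: powr_le1)
    qed
    then show "1 - 1 powr q \<noteq> 0 \<or> 0 < 1/p \<and> (\<forall>\<^sub>F h in at 0. 0 \<le> 1 - ?S h powr q)"
      using p by simp
  qed auto
  then have lim0: "((\<lambda>h. (1 - ?S h powr q) powr (1/p)) \<longlongrightarrow> 0) (at 0)"
    using p by simp
  show ?thesis
    unfolding DERIV_def
  proof (rule Lim_null_comparison[OF _ lim0])
    show "\<forall>\<^sub>F h in at 0. norm ((sin_pq p q (?P + h) - sin_pq p q ?P) / h)
            \<le> (1 - ?S h powr q) powr (1/p)"
      using bound pi_pq_pos
      by (auto simp: eventually_at dist_real_def intro!: exI[of _ ?P])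
  qed
qed

lemma cos_pq_eq:
  assumes "0 < x" "x \<le> pi_pq p q / 2"
  shows "cos_pq p q x = (1 - sin_pq p q x powr q) powr (1/p)"
proof (cases "x = pi_pq p q / 2")
  case True
  show ?thesis
    unfolding True using DERIV_imp_deriv[OF DERIV_sin_pq_half_pi] p
    by (simp add: cos_pq_def sin_pq_half_pi)
next
  case False
  then show ?thesis
    using DERIV_imp_deriv[OF DERIV_sin_pq] assms by (simp add: cos_pq_def)
qed

end

section \<open>Duplication of the lemniscatic arc\<close>

text \<open>
  The arc expressed through the cube root \<open>w\<close> of the cosine, that is twice the lemniscatic integral
  from \<open>w\<close> to \<open>1\<close>.
\<close>

definition arc_of_root :: "real \<Rightarrow> real" where
  "arc_of_root w = arcsin_pq (4/3) 2 (sqrt (1 - w^4))"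

text \<open>
  With \<open>cl\<close> the lemniscatic cosine, \<open>double_root (cl z) = cl (2 z)\<close> is its duplication formula.
\<close>

definition double_root :: "real \<Rightarrow> real" where
  "double_root u = (u^4 + 2 * u^2 - 1) / (1 + 2 * u^2 - u^4)"

lemma continuous_on_arc_of_root: "continuous_on {0..1} arc_of_root"
  unfolding arc_of_root_def[abs_def]
proof (rule continuous_on_compose2[OF continuous_on_arcsin_pq])
  show "continuous_on {0..1} (\<lambda>w::real. sqrt (1 - w^4))"
    by (intro continuous_intros)
qed (auto simp: power_le_one)

lemma DERIV_arc_of_root:
  assumes "0 < w" "w < 1"
  shows "(arc_of_root has_real_derivative - 2 / sqrt (1 - w^4)) (at w)"
proof -
  have w4: "0 < w^4" "w^4 < 1"
    using assms power_strict_mono[of w 1 4] by auto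
  let ?s = "sqrt (1 - w^4)"
  have "(w^4) powr (3/4) = w^3"
    using assms by (simp flip: powr_numeral add: powr_powr)
  moreover have "1 - ?s powr 2 = w^4"
    using w4 by (simp add: powr_numeral)
  ultimately have arc: "(arcsin_pq (4/3) 2 has_real_derivative 1 / w^3) (at ?s)"
    using DERIV_arcsin_pq[of "4/3" 2 ?s] w4 by simp
  have root: "((\<lambda>w. sqrt (1 - w^4)) has_real_derivative (- (4 * w^3) / (2 * ?s))) (at w)"
    using w4 by (auto intro!: derivative_eq_intros simp: field_simps)
  have "(arc_of_root has_real_derivative 1 / w^3 * (- (4 * w^3) / (2 * ?s))) (at w)"
    using DERIV_chain2[OF arc root] by (simp add: arc_of_root_def[abs_def])
  moreover have "1 / w^3 * (- (4 * w^3) / (2 * ?s)) = - 2 / ?s"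
    using assms by (simp add: field_simps)
  ultimately show ?thesis by metis
qed

lemma double_root_denom_pos:
  assumes "u \<in> {0..1}"
  shows "(1 + 2 * u^2 - u^4 :: real) > 0"
proof -
  have "u^4 \<le> u^2" "u^2 \<le> 1"
    using assms by (auto intro: power_le_one power_decreasing)
  then show ?thesis
    using zero_le_power2[of u] by linarith
qed

text \<open>
  With \<open>N\<close> and \<open>D\<close> the numerator and denominator of \<open>U\<close>, the difference \<open>D\<^sup>4 - N\<^sup>4\<close> splits into
  \<open>D\<^sup>2 - N\<^sup>2 = 8 u\<^sup>2 (1 - u\<^sup>4)\<close> and \<open>D\<^sup>2 + N\<^sup>2 = 2 (1 + u\<^sup>4)\<^sup>2\<close>.
\<close>

lemma one_minus_double_root_power4:
  assumes "u \<in> {0..1}"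
  shows "1 - double_root u ^ 4 = (4 * sqrt (1 - u^4) * u * (1 + u^4) / (1 + 2 * u^2 - u^4)^2)^2"
proof -
  let ?D = "1 + 2 * u^2 - u^4" and ?N = "u^4 + 2 * u^2 - 1"
  have D: "?D > 0" by (rule double_root_denom_pos[OF assms])
  have "1 - double_root u ^ 4 = (?D^4 - ?N^4) / ?D^4"
    using D by (simp add: double_root_def power_divide field_simps)
  also have "?D^4 - ?N^4 = 16 * (1 - u^4) * u^2 * (1 + u^4)^2"
    by algebra
  also have "\<dots> = (4 * sqrt (1 - u^4) * u * (1 + u^4))^2"
    using assms by (simp add: power_mult_distrib power_le_one)
  finally show ?thesis
    by (simp add: power_divide flip: power_mult)
qed

lemma sqrt_one_minus_double_root_power4:
  assumes "u \<in> {0..1}"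
  shows "sqrt (1 - double_root u ^ 4)
    = 4 * sqrt (1 - u^4) * u * (1 + u^4) / (1 + 2 * u^2 - u^4)^2"
  using assms by (simp add: one_minus_double_root_power4 power_le_one)

lemma DERIV_double_root:
  assumes "u \<in> {0..1}"
  shows "(double_root has_real_derivative 8 * u * (1 + u^4) / (1 + 2 * u^2 - u^4)^2) (at u)"
proof -
  let ?D = "1 + 2 * u^2 - u^4" and ?N = "u^4 + 2 * u^2 - 1"
  have D: "?D \<noteq> 0" using double_root_denom_pos[OF assms] by simp
  have "(double_root has_real_derivative
      ((4 * u^3 + 4 * u) * ?D - ?N * (4 * u - 4 * u^3)) / (?D * ?D)) (at u)"
    unfolding double_root_def[abs_def]
    using D by (auto intro!: derivative_eq_intros)
  moreover have "(4 * u^3 + 4 * u) * ?D - ?N * (4 * u - 4 * u^3) = 8 * u * (1 + u^4)"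
    by algebra
  ultimately show ?thesis by (simp add: power2_eq_square)
qed

lemma double_root_strict_mono:
  assumes "0 \<le> u" "u < v" "v \<le> 1"
  shows "double_root u < double_root v"
proof (rule DERIV_pos_imp_increasing_open[OF assms(2)])
  show "\<exists>D. (double_root has_real_derivative D) (at r) \<and> 0 < D" if "u < r" "r < v" for r
  proof (intro exI conjI)
    show "(double_root has_real_derivative 8 * r * (1 + r^4) / (1 + 2 * r^2 - r^4)^2) (at r)"
      using that assms by (intro DERIV_double_root) auto
    show "0 < 8 * r * (1 + r^4) / (1 + 2 * r^2 - r^4)^2"
      using that assms double_root_denom_pos[of r]
      by (intro divide_pos_pos mult_pos_pos) (auto simp: add_pos_nonneg)
  qed
  show "continuous_on {u..v} double_root"
    using assms by (intro continuous_at_imp_continuous_on ballI DERIV_isCont[OF DERIV_double_root]) auto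
qed

lemma double_root_0: "double_root 0 = -1" and double_root_1: "double_root 1 = 1"
  by (simp_all add: double_root_def)

lemma continuous_on_double_root: "continuous_on {0..1} double_root"
  by (intro continuous_at_imp_continuous_on ballI DERIV_isCont[OF DERIV_double_root]) auto

text \<open>
  The differential identity \<open>dU / sqrt (1 - U\<^sup>4) = 2 du / sqrt (1 - u\<^sup>4)\<close>. The sign \<open>\<sigma>\<close> treats the
  branches \<open>U > 0\<close> and \<open>U < 0\<close> together: the arc is only defined for nonnegative roots, so on the
  second branch it is taken at \<open>- U\<close>, which reverses its direction.
\<close>

lemma DERIV_arc_of_double_root:
  assumes "0 < u" "u < 1" and \<sigma>: "\<sigma> = 1 \<or> \<sigma> = -1" and pos: "0 < \<sigma> * double_root u"
  shows "((\<lambda>u. arc_of_root (\<sigma> * double_root u) - \<sigma> * (2 * arc_of_root u))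
          has_real_derivative 0) (at u)"
proof -
  let ?D = "1 + 2 * u^2 - u^4" and ?s = "sqrt (1 - u^4)" and ?U = "\<sigma> * double_root u"
  have s: "?s > 0" using assms power_strict_mono[of u 1 4] by simp
  have D: "?D > 0" using assms by (intro double_root_denom_pos) auto
  have U1: "?U < 1"
    using double_root_strict_mono[of 0 u] double_root_strict_mono[of u 1] assms
    by (auto simp: double_root_0 double_root_1)
  have U4: "?U ^ 4 = double_root u ^ 4" using \<sigma> by auto
  have S: "sqrt (1 - ?U ^ 4) = 4 * ?s * u * (1 + u^4) / ?D^2"
    unfolding U4 using assms by (intro sqrt_one_minus_double_root_power4) auto
  have dU: "((\<lambda>u. \<sigma> * double_root u) has_real_derivative \<sigma> * (8 * u * (1 + u^4) / ?D^2)) (at u)"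
    using assms by (intro DERIV_cmult DERIV_double_root) auto
  have "((\<lambda>u. arc_of_root (\<sigma> * double_root u) - \<sigma> * (2 * arc_of_root u)) has_real_derivative
          (- 2 / sqrt (1 - ?U ^ 4)) * (\<sigma> * (8 * u * (1 + u^4) / ?D^2)) - \<sigma> * (2 * (- 2 / ?s))) (at u)"
    using assms U1
    by (intro DERIV_diff DERIV_cmult DERIV_chain2[OF DERIV_arc_of_root dU] DERIV_arc_of_root) auto
  moreover have "1 + u^4 > 0" by (simp add: add_pos_nonneg)
  then have "(- 2 / sqrt (1 - ?U ^ 4)) * (\<sigma> * (8 * u * (1 + u^4) / ?D^2)) - \<sigma> * (2 * (- 2 / ?s)) = 0"
    unfolding S using s D assms(1) by (simp add: divide_simps)
  ultimately show ?thesis by simp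
qed

text \<open>
  On either side of the zero \<open>u0\<close> of \<open>double_root\<close>, the difference or sum of the two arcs has derivative
  \<open>0\<close> and is therefore constant. The endpoint \<open>u = 1\<close> determines the constant for \<open>u \<ge> u0\<close> and the
  endpoint \<open>u = 0\<close> that for \<open>u \<le> u0\<close>.
\<close>

lemma arc_of_double_root:
  assumes "u \<in> {0..1}"
  shows "0 \<le> double_root u \<Longrightarrow> arc_of_root (double_root u) = 2 * arc_of_root u"
    and "double_root u \<le> 0 \<Longrightarrow>
      arc_of_root (- double_root u) = pi_pq (4/3) 2 - 2 * arc_of_root u"
proof -
  obtain u0 where u0: "0 \<le> u0" "u0 \<le> 1" "double_root u0 = 0"
    using IVT'[of double_root 0 0 1] continuous_on_double_root
    by (auto simp: double_root_0 double_root_1)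
  have u0': "0 < u0" "u0 < 1"
    using u0 double_root_0 double_root_1 by (auto simp: less_le)
  have pos: "0 < double_root v" if "u0 < v" "v \<le> 1" for v
    using double_root_strict_mono[of u0 v] u0 that by simp
  have neg: "double_root v < 0" if "0 \<le> v" "v < u0" for v
    using double_root_strict_mono[of v u0] u0 that by simp
  have le1: "\<bar>double_root v\<bar> \<le> 1" if "0 \<le> v" "v \<le> 1" for v
    using double_root_strict_mono[of 0 v] double_root_strict_mono[of v 1] that
    by (cases "v = 0"; cases "v = 1") (auto simp: double_root_0 double_root_1)
  have cont: "continuous_on {a..b} (\<lambda>u. arc_of_root (\<sigma> * double_root u) - \<sigma> * (2 * arc_of_root u))"
    if "{a..b} \<subseteq> {0..1}" "\<And>v. v \<in> {a..b} \<Longrightarrow> 0 \<le> \<sigma> * double_root v" "\<sigma> = 1 \<or> \<sigma> = -1" for a b \<sigma>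
  proof (intro continuous_on_diff continuous_on_mult_left)
    show "continuous_on {a..b} arc_of_root"
      using that(1) continuous_on_arc_of_root by (auto intro: continuous_on_subset)
    have "continuous_on {a..b} double_root"
      using that(1) continuous_on_double_root by (auto intro: continuous_on_subset)
    moreover have "(\<lambda>u. \<sigma> * double_root u) ` {a..b} \<subseteq> {0..1}"
    proof (intro image_subsetI)
      fix v assume "v \<in> {a..b}"
      then show "\<sigma> * double_root v \<in> {0..1}"
        using le1[of v] that(1,3) that(2)[of v] by (auto simp: subset_iff)
    qed
    ultimately show "continuous_on {a..b} (\<lambda>u. arc_of_root (\<sigma> * double_root u))"
      by (intro continuous_on_compose2[OF continuous_on_arc_of_root] continuous_on_mult_left)
  qed
  have arc0: "arc_of_root 0 = pi_pq (4/3) 2 / 2" and arc1: "arc_of_root 1 = 0"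
    by (simp_all add: arc_of_root_def arcsin_pq_0 arcsin_pq_1)
  have upper: "arc_of_root (double_root v) - 2 * arc_of_root v
      = arc_of_root (double_root u0) - 2 * arc_of_root u0" if "u0 \<le> v" "v \<le> 1" for v
  proof (rule DERIV_isconst2[where a = u0 and b = 1
        and f = "\<lambda>v. arc_of_root (double_root v) - 2 * arc_of_root v"])
    show "continuous_on {u0..1} (\<lambda>v. arc_of_root (double_root v) - 2 * arc_of_root v)"
      using cont[of u0 1 1] u0 pos by (force simp: less_le)
    show "((\<lambda>v. arc_of_root (double_root v) - 2 * arc_of_root v) has_real_derivative 0) (at v)"
      if "u0 < v" "v < 1" for v
      using DERIV_arc_of_double_root[of v 1] pos that u0 by simp
  qed (use that u0' in auto)
  have lower: "arc_of_root (- double_root v) + 2 * arc_of_root v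
      = arc_of_root (- double_root 0) + 2 * arc_of_root 0" if "0 \<le> v" "v \<le> u0" for v
  proof (rule DERIV_isconst2[where a = 0 and b = u0
        and f = "\<lambda>v. arc_of_root (- double_root v) + 2 * arc_of_root v"])
    show "continuous_on {0..u0} (\<lambda>v. arc_of_root (- double_root v) + 2 * arc_of_root v)"
      using cont[of 0 u0 "-1"] u0 neg by (force simp: less_le)
    show "((\<lambda>v. arc_of_root (- double_root v) + 2 * arc_of_root v) has_real_derivative 0) (at v)"
      if "0 < v" "v < u0" for v
      using DERIV_arc_of_double_root[of v "-1"] neg that u0 by simp
  qed (use that u0' in auto)
  show "arc_of_root (double_root u) = 2 * arc_of_root u" if "0 \<le> double_root u"
  proof -
    have "u0 \<le> u" using neg[of u] that assms by force
    then show ?thesis using upper[of u] upper[of 1] u0 assms by (simp add: arc0 arc1 double_root_1)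
  qed
  show "arc_of_root (- double_root u) = pi_pq (4/3) 2 - 2 * arc_of_root u" if "double_root u \<le> 0"
  proof -
    have "u \<le> u0" using pos[of u] that assms by force
    then show ?thesis using lower[of u] assms by (simp add: arc0 arc1 double_root_0)
  qed
qed

section \<open>The double-angle formula\<close>

theorem theorem1p2:
  fixes x :: real
  assumes "x \<in> {0..pi_pq (4/3) 2 / 2}"
  shows "sin_pq (4/3) 2 (2 * x) =
    4 * sin_pq (4/3) 2 x * cos_pq (4/3) 2 x powr (1/3) * (1 + cos_pq (4/3) 2 x powr (4/3))
      / (2 * cos_pq (4/3) 2 x powr (2/3) + (sin_pq (4/3) 2 x)\<^sup>2)\<^sup>2"
proof (cases "x = 0")
  case True
  then show ?thesis by (simp add: sin_pq_0)
next
  case False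
  let ?s = "sin_pq (4/3) 2 x" and ?c = "cos_pq (4/3) 2 x"
  define u where "u = (1 - ?s^2) powr (1/4)"
  have s: "?s \<in> {0..1}"
    using assms by (intro sin_pq_in_unit) auto
  then have s2: "0 \<le> 1 - ?s^2" "1 - ?s^2 \<le> 1"
    by (auto simp: power_le_one)
  have u: "u \<in> {0..1}"
    using s2 by (auto simp: u_def intro: powr_le1)
  have u4: "u^4 = 1 - ?s^2"
    using s2 by (cases "?s^2 = 1") (auto simp: u_def powr_power)
  then have sqrt: "sqrt (1 - u^4) = ?s"
    using s by simp
  have u_pow: "(1 - ?s^2) powr (real n / 4) = u ^ n" if "n > 0" for n :: nat
    using s2 that by (cases "?s^2 = 1") (auto simp: u_def powr_power)
  have c: "?c = (1 - ?s^2) powr (3/4)"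
    using cos_pq_eq[of "4/3" 2 x] assms False s by (simp add: powr_numeral)
  have roots: "?c powr (1/3) = u" "?c powr (4/3) = u^4" "?c powr (2/3) = u^2"
    using u_pow[of 1] u_pow[of 4] u_pow[of 2] by (simp_all add: c powr_powr)
  let ?S = "sqrt (1 - double_root u ^ 4)"
  have "4 * ?s * ?c powr (1/3) * (1 + ?c powr (4/3)) / (2 * ?c powr (2/3) + ?s\<^sup>2)\<^sup>2
      = 4 * ?s * u * (1 + u^4) / (1 + 2 * u^2 - u^4)^2"
    by (simp add: roots u4 algebra_simps)
  also have "\<dots> = ?S"
    using sqrt_one_minus_double_root_power4[OF u] by (simp add: sqrt)
  also have "?S = sin_pq (4/3) 2 (arcsin_pq (4/3) 2 ?S)"
  proof (rule sin_pq_arcsin_pq[symmetric])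
    have "0 \<le> ?S"
      using one_minus_double_root_power4[OF u] by simp
    moreover have "?S \<le> 1" by simp
    ultimately show "?S \<in> {0..1}" by simp
  qed simp_all
  also have "\<dots> = sin_pq (4/3) 2 (2 * x)"
  proof -
    have arc: "arc_of_root u = x"
      using assms by (simp add: arc_of_root_def sqrt arcsin_pq_sin_pq)
    show ?thesis
    proof (cases "0 \<le> double_root u")
      case True
      then have "arcsin_pq (4/3) 2 ?S = 2 * x"
        using arc_of_double_root(1)[OF u] arc by (simp add: arc_of_root_def)
      then show ?thesis by simp
    next
      case False
      then have "arcsin_pq (4/3) 2 ?S = pi_pq (4/3) 2 - 2 * x"
        using arc_of_double_root(2)[OF u] arc by (simp add: arc_of_root_def)
      then show ?thesis
        using sin_pq_reflect[of "4/3" 2 "2 * x"] assms by simp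
    qed
  qed
  finally show ?thesis by simp
qed

end
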